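(* Let $M,K$ be real skew-symmetric $d\times d$ matrices and let $S(z,x)$ be a real-valued function, smooth in $z\in\mathbb{R}^d$, with gradient $\nabla_z S$ in $z$. Let $N$ be an even positive integer, $L>0$, $\Delta x=L/N$, $x_j=x_0+j\Delta x$ for $j=0,\ldots,N-1$, and $\Delta t>0$. Let $D=(D_{jk})_{0\le j,k\le N-1}$ be the Fourier pseudospectral differentiation matrix and let $A_{\tau,\sigma}$, $b_i$, $\langle\cdot\rangle_i$ ($i=1,\ldots,s$) be the objects attached to the continuous Runge--Kutta method with nodes $c_1,\ldots,c_s$ (all defined in the context). Suppose that the $\mathbb{R}^d$-valued polynomials $\tau\mapsto z_j^\tau$ and $\tau\mapsto \delta_t z_j^\tau$ ($j=0,\ldots,N-1$) satisfy the fully discrete scheme $$ \begin{aligned} &z_{j}^{\tau}=z_{j}^{0}+\Delta t\int_{0}^{1}A_{\tau,\sigma}\,\delta_{t}z_{j}^{\sigma}\,d\sigma,\qquad z_{j}^{1}=z_{j}^{0}+\Delta t\int_{0}^{1}\delta_{t}z_{j}^{\sigma}\,d\sigma,\\ &\delta_{x}z_{j}^{\tau}=\sum_{k=0}^{N-1}D_{jk}z_{k}^{\tau},\qquad M\delta_{t}z_{j}^{\tau}+K\delta_{x}z_{j}^{\tau}=\nabla_{z}S(z_{j}^{\tau},x_{j}), \end{aligned} $$ for all $\tau\in[0,1]$ and $j=0,1,\ldots,N-1$. Then the following $N$ discrete local energy conservation laws hold exactly: $$ \frac{E_{j}^{1}-E_{j}^{0}}{\Delta t}+\sum_{k=0}^{N-1}D_{jk}\bar{F}_{jk}=0,\qquad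 j=0,1,\ldots,N-1, $$ where $$ E_{j}^{\alpha}=S(z_{j}^{\alpha},x_{j})-\tfrac12 (z_{j}^{\alpha})^{\top}K\,\delta_{x}z_{j}^{\alpha}\quad(\alpha=0,1), $$ $$ \bar{F}_{jk}=\frac12\sum_{i=1}^{s}b_{i}\Big(\langle z_{j}\rangle_{i}^{\top}K\langle\delta_{t}z_{k}\rangle_{i}+\langle z_{k}\rangle_{i}^{\top}K\langle\delta_{t}z_{j}\rangle_{i}\Big). $$
   Context: The scheme discretizes the PDE $Mz_t+Kz_x=\nabla_z S(z,x)$ with periodic boundary condition $z(x_0,t)=z(x_0+L,t)$; here $z_j^\tau\approx z(x_j,t_0+\tau\Delta t)$ and $\delta_t z_j^\tau\approx\partial_t z(x_j,t_0+\tau\Delta t)$. The symbol $\delta_t z_j^\tau$ denotes an independent unknown function of $\tau$ tied to $z_j^\tau$ only through the scheme. Continuous Runge--Kutta (CRK) method: $c_1,\ldots,c_s$ are distinct real nodes, $l_1,\ldots,l_s$ are the Lagrange interpolating polynomials based on these nodes, $b_i=\int_0^1 l_i(\tau)\,d\tau$ (assumed nonzero), and $$A_{\tau,\sigma}=\sum_{i=1}^{s}\frac{1}{b_i}\left(\int_0^\tau l_i(\alpha)\,d\alpha\right) l_i(\sigma).$$ For a (scalar- or vector-valued) function $f$ of $\tau\in[0,1]$, $\langle f\rangle_i=\frac{1}{b_i}\int_0^1 l_i(\tau)f(\tau)\,d\tau$; e.g. $\langle z_j\rangle_i=\frac1{b_i}\int_0^1 l_i(\tau)z_j^\tau\,d\tau$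 and $\langle \delta_t z_j\rangle_i=\frac1{b_i}\int_0^1 l_i(\tau)\,\delta_t z_j^\tau\,d\tau$. Pseudospectral differentiation matrix: $D_{jk}=\frac{\pi}{L}(-1)^{j+k}\cot\!\big(\pi\frac{x_j-x_k}{L}\big)$ for $j\ne k$, and $D_{jj}=0$; it is skew-symmetric. *)

theory Defs
  imports "HOL-Analysis.Analysis"
begin

primrec C_k :: "nat \<Rightarrow> ('a::real_normed_vector \<Rightarrow> real) \<Rightarrow> bool" where
  "C_k 0 f \<longleftrightarrow> continuous_on UNIV f"
| "C_k (Suc n) f \<longleftrightarrow>
     (\<forall>z. f differentiable (at z)) \<and> (\<forall>v. C_k n (\<lambda>z. frechet_derivative f (at z) v))"

text \<open>On a finite-dimensional space this is the usual notion of a \<open>C\<^sup>\<infinity>\<close> function: all iterated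
  directional derivatives exist and are continuous.\<close>

definition smooth :: "('a::euclidean_space \<Rightarrow> real) \<Rightarrow> bool" where
  "smooth f \<longleftrightarrow> (\<forall>n. C_k n f)"

definition gradient :: "('a::real_inner \<Rightarrow> real) \<Rightarrow> 'a \<Rightarrow> 'a" where
  "gradient f z = (THE g. GDERIV f z :> g)"

lemma gradient_eqI:
  assumes "GDERIV f z :> g"
  shows "gradient f z = g"
  unfolding gradient_def
proof (rule the_equality)
  show "GDERIV f z :> g" by (rule assms)
next
  fix g' assume "GDERIV f z :> g'"
  then have "(\<lambda>h. inner h g') = (\<lambda>h. inner h g)"
    using assms has_derivative_unique unfolding gderiv_def by blast
  then have "\<And>h. inner h g' = inner h g" by (rule fun_cong)
  then show "g' = g" using vector_eq_ldot by blast
qed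

text \<open>Nodes and stages are indexed by \<open>{1..s}\<close>, grid points by \<open>{..<N}\<close>.\<close>

definition lagrange_basis :: "(nat \<Rightarrow> real) \<Rightarrow> nat \<Rightarrow> nat \<Rightarrow> real \<Rightarrow> real" where
  "lagrange_basis c s i \<tau> = (\<Prod>k\<in>{1..s} - {i}. (\<tau> - c k) / (c i - c k))"

definition crk_b :: "(nat \<Rightarrow> real) \<Rightarrow> nat \<Rightarrow> nat \<Rightarrow> real" where
  "crk_b c s i = integral {0..1} (lagrange_basis c s i)"

text \<open>Only meant for \<open>\<tau> \<ge> 0\<close>: the inner integral over \<open>{0..\<tau>}\<close> is not an oriented integral.\<close>

definition crk_A :: "(nat \<Rightarrow> real) \<Rightarrow> nat \<Rightarrow> real \<Rightarrow> real \<Rightarrow> real" where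
  "crk_A c s \<tau> \<sigma> =
     (\<Sum>i = 1..s. 1 / crk_b c s i * integral {0..\<tau>} (lagrange_basis c s i) * lagrange_basis c s i \<sigma>)"

definition crk_mean ::
  "(nat \<Rightarrow> real) \<Rightarrow> nat \<Rightarrow> nat \<Rightarrow> (real \<Rightarrow> 'a::euclidean_space) \<Rightarrow> 'a" where
  "crk_mean c s i f =
     (1 / crk_b c s i) *\<^sub>R integral {0..1} (\<lambda>\<tau>. lagrange_basis c s i \<tau> *\<^sub>R f \<tau>)"

definition grid_point :: "real \<Rightarrow> real \<Rightarrow> nat \<Rightarrow> nat \<Rightarrow> real" where
  "grid_point x0 L N j = x0 + real j * (L / real N)"

definition fourier_D :: "real \<Rightarrow> real \<Rightarrow> nat \<Rightarrow> nat \<Rightarrow> nat \<Rightarrow> real" where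
  "fourier_D x0 L N j k =
     (if j = k then 0
      else pi / L * (-1) ^ (j + k) * cot (pi * ((grid_point x0 L N j - grid_point x0 L N k) / L)))"

text \<open>\<open>w\<close> stands for the discrete spatial derivative \<open>\<delta>\<^sub>x z\<close> at the grid point \<open>x\<close>.\<close>

definition local_energy ::
  "(real ^ 'd \<Rightarrow> real \<Rightarrow> real) \<Rightarrow> real ^ 'd ^ 'd \<Rightarrow> real \<Rightarrow> real ^ 'd \<Rightarrow> real ^ 'd \<Rightarrow> real" where
  "local_energy S K x z w = S z x - 1 / 2 * (z \<bullet> (K *v w))"

text \<open>\<open>dz j\<close> stands for \<open>\<delta>\<^sub>t z\<^sub>j\<close>, which is an unknown of its own and not the derivative
  of \<open>z j\<close>.\<close>

definition local_flux ::
  "(nat \<Rightarrow> real) \<Rightarrow> nat \<Rightarrow> real ^ 'd ^ 'd \<Rightarrow> (nat \<Rightarrow> real \<Rightarrow> real ^ 'd) \<Rightarrow>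
   (nat \<Rightarrow> real \<Rightarrow> real ^ 'd) \<Rightarrow> nat \<Rightarrow> nat \<Rightarrow> real" where
  "local_flux c s K z dz j k =
     1 / 2 * (\<Sum>i = 1..s. crk_b c s i *
       (crk_mean c s i (z j) \<bullet> (K *v crk_mean c s i (dz k)) +
        crk_mean c s i (z k) \<bullet> (K *v crk_mean c s i (dz j))))"

end

theory Submission
  imports Defs
begin

text \<open>On \<open>[0,1]\<close> the stage equation says that \<open>z j\<close> has derivative
  \<open>dt * (\<Sum>i. l\<^sub>i * \<langle>\<delta>t j\<rangle>\<^sub>i)\<close>. So integrating \<open>g \<bullet> z j'\<close> produces
  \<open>dt * (\<Sum>i. b\<^sub>i * (\<langle>g\<rangle>\<^sub>i \<bullet> \<langle>\<delta>t j\<rangle>\<^sub>i))\<close> for every continuous \<open>g\<close>. With \<open>g = \<nabla>S\<close>, replaced through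
  the scheme, the \<open>M\<close>-terms \<open>(M \<langle>\<delta>t j\<rangle>\<^sub>i) \<bullet> \<langle>\<delta>t j\<rangle>\<^sub>i\<close> vanish; with \<open>g = K z k\<close> the product rule
  yields the increment of the bilinear part of the energy. The increments then match the flux for
  each \<open>k\<close> separately.\<close>

section \<open>Gradients and the chain rule along a curve\<close>

lemma smooth_imp_differentiable: "smooth f \<Longrightarrow> f differentiable (at z)"
  unfolding smooth_def by (metis C_k.simps(2))

text \<open>\<open>gradient\<close> is a definite description, so a representing vector has to be
  exhibited. The derivative \<open>f'\<close> is a linear functional, and
  \<open>adjoint f' 1\<close> is its Riesz vector, since
  \<open>f' h = f' h \<bullet> 1 = h \<bullet> adjoint f' 1\<close>.\<close>

lemma gderiv_gradient:
  fixes f :: "'a::euclidean_space \<Rightarrow> real"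
  assumes "f differentiable (at z)"
  shows "GDERIV f z :> gradient f z"
proof -
  from assms obtain f' where f': "(f has_derivative f') (at z)"
    unfolding differentiable_def by blast
  then have "linear f'"
    by (rule has_derivative_linear)
  then have "f' = (\<lambda>h. h \<bullet> adjoint f' 1)"
    by (simp add: fun_eq_iff adjoint_works)
  with f' have "GDERIV f z :> adjoint f' 1"
    unfolding gderiv_def by simp
  then show ?thesis
    using gradient_eqI by metis
qed

text \<open>The curve is differentiated only within \<open>T\<close>, because the scheme controls
  \<open>z j\<close> on \<open>{0..1}\<close> alone.\<close>

lemma has_real_derivative_compose_gradient:
  fixes f :: "'a::euclidean_space \<Rightarrow> real"
  assumes "f differentiable (at (p t))" and "(p has_vector_derivative v) (at t within T)"
  shows "((\<lambda>t. f (p t)) has_real_derivative gradient f (p t) \<bullet> v) (at t within T)"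
proof -
  have "(f has_derivative (\<lambda>h. h \<bullet> gradient f (p t))) (at (p t))"
    using gderiv_gradient[OF assms(1)] unfolding gderiv_def .
  from has_derivative_compose[OF assms(2)[unfolded has_vector_derivative_def] this]
  show ?thesis
    by (simp add: has_field_derivative_def inner_commute mult.commute[of _ "_ \<bullet> _"])
qed

section \<open>Skew-symmetric matrices\<close>

lemma skew_inner_left:
  fixes K :: "real ^ 'd ^ 'd"
  assumes "transpose K = - K"
  shows "(K *v u) \<bullet> v = - (u \<bullet> (K *v v))"
proof -
  have "(K *v u) \<bullet> v = u \<bullet> (transpose K *v v)"
    by (metis dot_lmul_matrix inner_commute transpose_matrix_vector)
  then show ?thesis
    using assms by (simp add: matrix_vector_mult_def sum_negf vec_eq_iff inner_vec_def)
qed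

lemma skew_inner_self:
  fixes K :: "real ^ 'd ^ 'd"
  assumes "transpose K = - K"
  shows "(K *v u) \<bullet> u = 0"
  using skew_inner_left[OF assms, of u u] by (simp add: inner_commute)

section \<open>Lagrange-weighted means\<close>

lemma continuous_on_lagrange_basis [continuous_intros]:
  "continuous_on T (lagrange_basis c s i)"
  unfolding lagrange_basis_def[abs_def] divide_inverse by (intro continuous_intros)

text \<open>Recovers the integral from the mean. With \<open>crk_b c s i = 0\<close> the convention
  \<open>1 / 0 = 0\<close> would make the mean zero and lose the integral.\<close>

lemma has_integral_lagrange_scaleR:
  fixes f :: "real \<Rightarrow> 'a::euclidean_space"
  assumes "continuous_on {0..1} f" and "crk_b c s i \<noteq> 0"
  shows "((\<lambda>\<tau>. lagrange_basis c s i \<tau> *\<^sub>R f \<tau>) has_integral crk_b c s i *\<^sub>R crk_mean c s i f) {0..1}"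
proof -
  have "(\<lambda>\<tau>. lagrange_basis c s i \<tau> *\<^sub>R f \<tau>) integrable_on {0..1}"
    by (intro integrable_continuous_interval continuous_intros assms)
  with assms(2) show ?thesis
    by (simp add: crk_mean_def integrable_integral)
qed

text \<open>Bounded linear maps commute with integration. This is how means pass through
  \<open>M\<close>, \<open>K\<close> and scalar factors.\<close>

lemma crk_mean_linear:
  fixes f :: "real \<Rightarrow> 'a::euclidean_space" and h :: "'a \<Rightarrow> 'b::euclidean_space"
  assumes "continuous_on {0..1} f" and "bounded_linear h"
  shows "crk_mean c s i (\<lambda>\<tau>. h (f \<tau>)) = h (crk_mean c s i f)"
proof -
  interpret h: bounded_linear h by fact
  have "(\<lambda>\<tau>. lagrange_basis c s i \<tau> *\<^sub>R f \<tau>) integrable_on {0..1}"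
    by (intro integrable_continuous_interval continuous_intros assms)
  from integral_linear[OF this assms(2)] show ?thesis
    by (simp add: crk_mean_def o_def h.scaleR)
qed

lemma crk_mean_add:
  fixes f g :: "real \<Rightarrow> 'a::euclidean_space"
  assumes "continuous_on {0..1} f" and "continuous_on {0..1} g"
  shows "crk_mean c s i (\<lambda>\<tau>. f \<tau> + g \<tau>) = crk_mean c s i f + crk_mean c s i g"
proof -
  have "(\<lambda>\<tau>. lagrange_basis c s i \<tau> *\<^sub>R f \<tau>) integrable_on {0..1}"
    "(\<lambda>\<tau>. lagrange_basis c s i \<tau> *\<^sub>R g \<tau>) integrable_on {0..1}"
    by (intro integrable_continuous_interval continuous_intros assms)+
  then show ?thesis
    by (simp add: crk_mean_def scaleR_right_distrib integral_add)
qed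

lemma crk_mean_sum_scaleR:
  fixes f :: "nat \<Rightarrow> real \<Rightarrow> 'a::euclidean_space"
  assumes "\<And>k. k < N \<Longrightarrow> continuous_on {0..1} (f k)"
  shows "crk_mean c s i (\<lambda>\<tau>. \<Sum>k<N. a k *\<^sub>R f k \<tau>) = (\<Sum>k<N. a k *\<^sub>R crk_mean c s i (f k))"
  using assms
proof (induction N)
  case 0
  show ?case by (simp add: crk_mean_def)
next
  case (Suc N)
  have "crk_mean c s i (\<lambda>\<tau>. (\<Sum>k<N. a k *\<^sub>R f k \<tau>) + a N *\<^sub>R f N \<tau>)
      = crk_mean c s i (\<lambda>\<tau>. \<Sum>k<N. a k *\<^sub>R f k \<tau>) + crk_mean c s i (\<lambda>\<tau>. a N *\<^sub>R f N \<tau>)"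
    by (intro crk_mean_add continuous_intros Suc.prems) auto
  with Suc show ?case
    by (simp add: crk_mean_linear bounded_linear_scaleR_right)
qed

section \<open>The continuous Runge-Kutta stage equation\<close>

text \<open>The kernel is degenerate: each summand splits into a factor in \<tau> and a factor in
  \<sigma>. Hence \<open>f\<close> enters only through its \<open>s\<close> means, whose
  normalisation is the factor \<open>1 / crk_b c s i\<close> of the kernel.\<close>

lemma integral_crk_A_scaleR:
  fixes f :: "real \<Rightarrow> 'a::euclidean_space"
  assumes "continuous_on {0..1} f"
  shows "integral {0..1} (\<lambda>\<sigma>. crk_A c s \<tau> \<sigma> *\<^sub>R f \<sigma>)
    = (\<Sum>i = 1..s. integral {0..\<tau>} (lagrange_basis c s i) *\<^sub>R crk_mean c s i f)"
proof -
  let ?a = "\<lambda>i. 1 / crk_b c s i * integral {0..\<tau>} (lagrange_basis c s i)"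
  have "integral {0..1} (\<lambda>\<sigma>. crk_A c s \<tau> \<sigma> *\<^sub>R f \<sigma>)
      = integral {0..1} (\<lambda>\<sigma>. \<Sum>i = 1..s. ?a i *\<^sub>R (lagrange_basis c s i \<sigma> *\<^sub>R f \<sigma>))"
    by (simp add: crk_A_def scaleR_sum_left)
  also have "\<dots> = (\<Sum>i = 1..s. integral {0..1} (\<lambda>\<sigma>. ?a i *\<^sub>R (lagrange_basis c s i \<sigma> *\<^sub>R f \<sigma>)))"
    by (intro integral_sum integrable_continuous_interval continuous_intros assms) auto
  also have "\<dots> = (\<Sum>i = 1..s. integral {0..\<tau>} (lagrange_basis c s i) *\<^sub>R crk_mean c s i f)"
    by (simp only: integral_cmul) (simp add: crk_mean_def)
  finally show ?thesis .
qed

text \<open>After the kernel is split, \<tau> occurs only as an upper limit of integration, so the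
  fundamental theorem of calculus applies. The derivative is in general not
  \<open>dt *\<^sub>R f t\<close>, but a combination of the basis polynomials weighted by the means
  of \<open>f\<close>.\<close>

lemma crk_stage_has_vector_derivative:
  fixes z f :: "real \<Rightarrow> 'a::euclidean_space"
  assumes "continuous_on {0..1} f" and "t \<in> {0..1}"
    and "\<And>\<tau>. \<tau> \<in> {0..1} \<Longrightarrow>
           z \<tau> = z 0 + dt *\<^sub>R integral {0..1} (\<lambda>\<sigma>. crk_A c s \<tau> \<sigma> *\<^sub>R f \<sigma>)"
  shows "(z has_vector_derivative dt *\<^sub>R (\<Sum>i = 1..s. lagrange_basis c s i t *\<^sub>R crk_mean c s i f))
    (at t within {0..1})"
proof -
  have l: "((\<lambda>\<tau>. integral {0..\<tau>} (lagrange_basis c s i))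
      has_real_derivative lagrange_basis c s i t) (at t within {0..1})" for i
    using assms(2) by (intro integral_has_real_derivative continuous_intros)
  have "((\<lambda>\<tau>. z 0 + dt *\<^sub>R (\<Sum>i = 1..s. integral {0..\<tau>} (lagrange_basis c s i) *\<^sub>R crk_mean c s i f))
      has_vector_derivative dt *\<^sub>R (\<Sum>i = 1..s. lagrange_basis c s i t *\<^sub>R crk_mean c s i f))
    (at t within {0..1})"
    by (auto intro!: derivative_eq_intros l)
  then show ?thesis
    by (rule has_vector_derivative_transform[OF assms(2), rotated])
      (metis assms(3) integral_crk_A_scaleR[OF assms(1)])
qed

text \<open>The scalar weight \<open>lagrange_basis c s i \<tau>\<close> can be moved from the stage
  derivative onto \<open>g\<close>, where integration turns it into a mean. Integrals of pointwise
  products thus become sums of products of means, the form in which the flux is stated.\<close>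

lemma has_integral_inner_crk_stage:
  fixes g :: "real \<Rightarrow> 'a::euclidean_space"
  assumes "continuous_on {0..1} g" and "\<And>i. i \<in> {1..s} \<Longrightarrow> crk_b c s i \<noteq> 0"
  shows "((\<lambda>\<tau>. g \<tau> \<bullet> (dt *\<^sub>R (\<Sum>i = 1..s. lagrange_basis c s i \<tau> *\<^sub>R y i)))
    has_integral dt * (\<Sum>i = 1..s. crk_b c s i * (crk_mean c s i g \<bullet> y i))) {0..1}"
proof -
  have inner: "((\<lambda>\<tau>. (lagrange_basis c s i \<tau> *\<^sub>R g \<tau>) \<bullet> y i)
      has_integral (crk_b c s i *\<^sub>R crk_mean c s i g) \<bullet> y i) {0..1}" if "i \<in> {1..s}" for i
    using has_integral_linear[OF has_integral_lagrange_scaleR[OF assms(1) assms(2)[OF that]]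
        bounded_linear_inner_left] by (simp add: o_def)
  have "((\<lambda>\<tau>. dt * (\<Sum>i = 1..s. (lagrange_basis c s i \<tau> *\<^sub>R g \<tau>) \<bullet> y i))
    has_integral dt * (\<Sum>i = 1..s. (crk_b c s i *\<^sub>R crk_mean c s i g) \<bullet> y i)) {0..1}"
    by (intro has_integral_mult_right has_integral_sum inner) auto
  then show ?thesis
    by (simp add: inner_sum_right)
qed

section \<open>Increments of the potential and of the bilinear energy term\<close>

text \<open>The integral of \<open>gradient f (z \<tau>)\<close> against the stage derivative is
  evaluated twice: by the chain rule and by means. The function \<open>g\<close> stands for the
  expression that the scheme supplies for the gradient along \<open>z\<close>.\<close>

lemma crk_potential_increment:
  fixes f :: "'a::euclidean_space \<Rightarrow> real"
  assumes "\<And>v. f differentiable (at v)" and "\<And>i. i \<in> {1..s} \<Longrightarrow> crk_b c s i \<noteq> 0"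
    and z: "\<And>\<tau>. \<tau> \<in> {0..1} \<Longrightarrow> (z has_vector_derivative
          dt *\<^sub>R (\<Sum>i = 1..s. lagrange_basis c s i \<tau> *\<^sub>R y i)) (at \<tau> within {0..1})"
    and g: "continuous_on {0..1} g" "\<And>\<tau>. \<tau> \<in> {0..1} \<Longrightarrow> gradient f (z \<tau>) = g \<tau>"
  shows "f (z 1) - f (z 0) = dt * (\<Sum>i = 1..s. crk_b c s i * (crk_mean c s i g \<bullet> y i))"
proof -
  have "((\<lambda>\<tau>. g \<tau> \<bullet> (dt *\<^sub>R (\<Sum>i = 1..s. lagrange_basis c s i \<tau> *\<^sub>R y i)))
      has_integral f (z 1) - f (z 0)) {0..1}"
  proof (rule fundamental_theorem_of_calculus)
    fix \<tau> :: real assume t: "\<tau> \<in> {0..1}"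
    from has_real_derivative_compose_gradient[OF assms(1) z[OF t]]
    show "((\<lambda>\<tau>. f (z \<tau>)) has_vector_derivative
        g \<tau> \<bullet> (dt *\<^sub>R (\<Sum>i = 1..s. lagrange_basis c s i \<tau> *\<^sub>R y i))) (at \<tau> within {0..1})"
      by (simp add: has_real_derivative_iff_has_vector_derivative g(2)[OF t])
  qed simp
  from has_integral_unique[OF this has_integral_inner_crk_stage[OF g(1) assms(2)]]
  show ?thesis .
qed

text \<open>Skew-symmetry rewrites the product rule for \<open>p \<bullet> (K *v q)\<close> as
  \<open>K *v q\<close> against the derivative of \<open>p\<close> minus \<open>K *v p\<close>
  against that of \<open>q\<close>. Both terms then have the shape of a continuous function against
  a stage derivative.\<close>

lemma crk_bilinear_increment:
  fixes K :: "real ^ 'd ^ 'd"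
  assumes "transpose K = - K" and b: "\<And>i. i \<in> {1..s} \<Longrightarrow> crk_b c s i \<noteq> 0"
    and p: "\<And>\<tau>. \<tau> \<in> {0..1} \<Longrightarrow> (p has_vector_derivative
          dt *\<^sub>R (\<Sum>i = 1..s. lagrange_basis c s i \<tau> *\<^sub>R u i)) (at \<tau> within {0..1})"
    and q: "\<And>\<tau>. \<tau> \<in> {0..1} \<Longrightarrow> (q has_vector_derivative
          dt *\<^sub>R (\<Sum>i = 1..s. lagrange_basis c s i \<tau> *\<^sub>R v i)) (at \<tau> within {0..1})"
  shows "p 1 \<bullet> (K *v q 1) - p 0 \<bullet> (K *v q 0) =
    dt * (\<Sum>i = 1..s. crk_b c s i *
      (crk_mean c s i p \<bullet> (K *v v i) - crk_mean c s i q \<bullet> (K *v u i)))"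
proof -
  let ?p' = "\<lambda>\<tau>. dt *\<^sub>R (\<Sum>i = 1..s. lagrange_basis c s i \<tau> *\<^sub>R u i)"
  let ?q' = "\<lambda>\<tau>. dt *\<^sub>R (\<Sum>i = 1..s. lagrange_basis c s i \<tau> *\<^sub>R v i)"
  have Kl: "bounded_linear ((*v) K)"
    by simp
  have cont: "continuous_on {0..1} p" "continuous_on {0..1} q"
    using p q by (meson continuous_on_eq_continuous_within has_vector_derivative_continuous)+
  then have contK: "continuous_on {0..1} (\<lambda>\<tau>. K *v p \<tau>)" "continuous_on {0..1} (\<lambda>\<tau>. K *v q \<tau>)"
    by (auto intro: bounded_linear.continuous_on[OF Kl])
  have "((\<lambda>\<tau>. (K *v q \<tau>) \<bullet> ?p' \<tau> - (K *v p \<tau>) \<bullet> ?q' \<tau>)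
      has_integral p 1 \<bullet> (K *v q 1) - p 0 \<bullet> (K *v q 0)) {0..1}"
  proof (rule fundamental_theorem_of_calculus)
    fix \<tau> :: real assume t: "\<tau> \<in> {0..1}"
    have "((\<lambda>\<tau>. p \<tau> \<bullet> (K *v q \<tau>)) has_vector_derivative
        p \<tau> \<bullet> (K *v ?q' \<tau>) + ?p' \<tau> \<bullet> (K *v q \<tau>)) (at \<tau> within {0..1})"
      by (intro bounded_bilinear.has_vector_derivative[OF bounded_bilinear_inner] p q t
          bounded_linear.has_vector_derivative[OF Kl])
    then show "((\<lambda>\<tau>. p \<tau> \<bullet> (K *v q \<tau>)) has_vector_derivative
        (K *v q \<tau>) \<bullet> ?p' \<tau> - (K *v p \<tau>) \<bullet> ?q' \<tau>) (at \<tau> within {0..1})"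
      by (simp only: skew_inner_left[OF assms(1), of "p \<tau>"] inner_commute[of "?p' \<tau>"]
          diff_minus_eq_add add.commute)
  qed simp
  \<comment> \<open>The same integrand is now evaluated through means, with
    \<open>K *v q \<tau>\<close> and \<open>K *v p \<tau>\<close> in the role of
    \<open>g\<close>.\<close>
  moreover have "((\<lambda>\<tau>. (K *v q \<tau>) \<bullet> ?p' \<tau> - (K *v p \<tau>) \<bullet> ?q' \<tau>) has_integral
      dt * (\<Sum>i = 1..s. crk_b c s i * (crk_mean c s i (\<lambda>\<tau>. K *v q \<tau>) \<bullet> u i))
      - dt * (\<Sum>i = 1..s. crk_b c s i * (crk_mean c s i (\<lambda>\<tau>. K *v p \<tau>) \<bullet> v i))) {0..1}"
    by (intro has_integral_diff has_integral_inner_crk_stage contK b)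
  ultimately have "p 1 \<bullet> (K *v q 1) - p 0 \<bullet> (K *v q 0) =
      dt * (\<Sum>i = 1..s. crk_b c s i * (crk_mean c s i (\<lambda>\<tau>. K *v q \<tau>) \<bullet> u i))
      - dt * (\<Sum>i = 1..s. crk_b c s i * (crk_mean c s i (\<lambda>\<tau>. K *v p \<tau>) \<bullet> v i))"
    by (rule has_integral_unique)
  then show ?thesis
    by (simp add: crk_mean_linear[OF cont(1) Kl] crk_mean_linear[OF cont(2) Kl]
        skew_inner_left[OF assms(1)] right_diff_distrib sum_subtractf sum_negf)
qed

section \<open>Assembly of the local energy balance\<close>

theorem theorem3p1:
  fixes M K :: "real ^ 'd ^ 'd"
    and S :: "real ^ 'd \<Rightarrow> real \<Rightarrow> real"
    and N s :: nat
    and L x0 dt :: real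
    and c :: "nat \<Rightarrow> real"
    and z \<delta>t \<delta>x :: "nat \<Rightarrow> real \<Rightarrow> real ^ 'd"
  assumes "transpose M = - M" and "transpose K = - K"
    and "\<And>x. smooth (\<lambda>v. S v x)"
    and "even N" and "N > 0" and "L > 0" and "dt > 0"
    and "s \<ge> 1" and "inj_on c {1..s}"
    and "\<And>i. i \<in> {1..s} \<Longrightarrow> crk_b c s i \<noteq> 0"
    and "\<And>j. j < N \<Longrightarrow> polynomial_function (z j)"
    and "\<And>j. j < N \<Longrightarrow> polynomial_function (\<delta>t j)"
    and "\<And>j \<tau>. j < N \<Longrightarrow> \<tau> \<in> {0..1} \<Longrightarrow>
           z j \<tau> = z j 0 + dt *\<^sub>R integral {0..1} (\<lambda>\<sigma>. crk_A c s \<tau> \<sigma> *\<^sub>R \<delta>t j \<sigma>)"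
    and "\<And>j. j < N \<Longrightarrow> z j 1 = z j 0 + dt *\<^sub>R integral {0..1} (\<delta>t j)"
    and "\<And>j \<tau>. j < N \<Longrightarrow> \<tau> \<in> {0..1} \<Longrightarrow>
           \<delta>x j \<tau> = (\<Sum>k<N. fourier_D x0 L N j k *\<^sub>R z k \<tau>)"
    and "\<And>j \<tau>. j < N \<Longrightarrow> \<tau> \<in> {0..1} \<Longrightarrow>
           M *v \<delta>t j \<tau> + K *v \<delta>x j \<tau> = gradient (\<lambda>v. S v (grid_point x0 L N j)) (z j \<tau>)"
  shows "\<forall>j<N.
           (local_energy S K (grid_point x0 L N j) (z j 1) (\<delta>x j 1)
             - local_energy S K (grid_point x0 L N j) (z j 0) (\<delta>x j 0)) / dt
           + (\<Sum>k<N. fourier_D x0 L N j k * local_flux c s K z \<delta>t j k) = 0"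
proof (intro allI impI)
  note skew = assms(1,2) and b = assms(10)
  fix j assume j: "j < N"
  define x where "x = grid_point x0 L N j"
  define D where "D = fourier_D x0 L N j"
  define y where "y k i = crk_mean c s i (\<delta>t k)" for k i
  define m where "m k i = crk_mean c s i (z k)" for k i
  have cont_z: "continuous_on {0..1} (z k)" and cont_dz: "continuous_on {0..1} (\<delta>t k)"
    if "k < N" for k
    using assms(11,12) that continuous_on_polymonial_function by blast+
  have z': "(z k has_vector_derivative dt *\<^sub>R (\<Sum>i = 1..s. lagrange_basis c s i \<tau> *\<^sub>R y k i))
      (at \<tau> within {0..1})" if "k < N" "\<tau> \<in> {0..1}" for k \<tau>
    unfolding y_def using that
    by (intro crk_stage_has_vector_derivative cont_dz assms(13)) auto
  have dx: "\<delta>x j \<tau> = (\<Sum>k<N. D k *\<^sub>R z k \<tau>)" if "\<tau> \<in> {0..1}" for \<tau>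
    using assms(15)[OF j that] unfolding D_def .

  have cont_sum: "continuous_on {0..1} (\<lambda>\<tau>. \<Sum>k<N. D k *\<^sub>R z k \<tau>)"
    by (intro continuous_intros cont_z) auto
  \<comment> \<open>The left-hand side of the scheme with \<open>\<delta>x j\<close> expanded, since
    \<open>\<delta>x j\<close> is prescribed only on \<open>{0..1}\<close>. The expanded form is
    visibly continuous, and its mean splits over the grid points.\<close>
  let ?g = "\<lambda>\<tau>. M *v \<delta>t j \<tau> + K *v (\<Sum>k<N. D k *\<^sub>R z k \<tau>)"
  have lin: "bounded_linear ((*v) A)" for A :: "real ^ 'd ^ 'd"
    by simp
  have cont_M: "continuous_on {0..1} (\<lambda>\<tau>. M *v \<delta>t j \<tau>)"
    and cont_K: "continuous_on {0..1} (\<lambda>\<tau>. K *v (\<Sum>k<N. D k *\<^sub>R z k \<tau>))"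
    by (intro bounded_linear.continuous_on[OF lin] cont_dz[OF j] cont_sum)+
  \<comment> \<open>The vectors \<open>y j i\<close> that test \<open>?g\<close> are the very means
    of \<open>\<delta>t j\<close> on which \<open>M\<close> acts, so the \<open>M\<close>-term is a
    skew form on the diagonal. Moving \<open>K\<close> to the other factor gives the minus
    sign.\<close>
  have mean_g: "crk_mean c s i ?g \<bullet> y j i = - (\<Sum>k<N. D k * (m k i \<bullet> (K *v y j i)))" for i
  proof -
    have "crk_mean c s i ?g = M *v y j i + K *v (\<Sum>k<N. D k *\<^sub>R m k i)"
      by (simp add: crk_mean_add[OF cont_M cont_K] crk_mean_linear[OF cont_dz[OF j] lin]
          crk_mean_linear[OF cont_sum lin] crk_mean_sum_scaleR cont_z y_def m_def)
    then show ?thesis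
      by (simp add: inner_add_left skew_inner_self[OF skew(1)] skew_inner_left[OF skew(2)]
          inner_sum_left)
  qed
  have "S (z j 1) x - S (z j 0) x = dt * (\<Sum>i = 1..s. crk_b c s i * (crk_mean c s i ?g \<bullet> y j i))"
  proof (rule crk_potential_increment[where f = "\<lambda>v. S v x", OF _ b z'[OF j]])
    show "(\<lambda>v. S v x) differentiable (at v)" for v
      by (intro smooth_imp_differentiable assms(3))
    show "continuous_on {0..1} ?g"
      by (intro continuous_on_add cont_M cont_K)
    show "gradient (\<lambda>v. S v x) (z j \<tau>) = ?g \<tau>" if "\<tau> \<in> {0..1}" for \<tau>
      using assms(16)[OF j that] by (simp add: x_def dx[OF that])
  qed
  also have "\<dots> = - dt * (\<Sum>i = 1..s. \<Sum>k<N. D k * (crk_b c s i * (m k i \<bullet> (K *v y j i))))"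
    by (simp add: mean_g sum_negf sum_distrib_left mult_ac)
  \<comment> \<open>The sum over grid points goes outside, so that the coefficients of
    \<open>D k\<close> can be compared.\<close>
  also have "\<dots> = - dt * (\<Sum>k<N. D k * (\<Sum>i = 1..s. crk_b c s i * (m k i \<bullet> (K *v y j i))))"
    by (subst sum.swap) (simp add: sum_distrib_left)
  finally have S_incr: "S (z j 1) x - S (z j 0) x =
      - dt * (\<Sum>k<N. D k * (\<Sum>i = 1..s. crk_b c s i * (m k i \<bullet> (K *v y j i))))" .

  \<comment> \<open>\<open>D k\<close> does not depend on \<tau>, so the bilinear term splits into
    pairs \<open>(j, k)\<close>. Each pair couples two stage curves, which is why \<open>z'\<close>
    is needed at every grid point and not only at \<open>j\<close>.\<close>
  have "z j 1 \<bullet> (K *v \<delta>x j 1) - z j 0 \<bullet> (K *v \<delta>x j 0)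
      = (\<Sum>k<N. D k * (z j 1 \<bullet> (K *v z k 1) - z j 0 \<bullet> (K *v z k 0)))"
    by (simp add: dx linear_sum[OF matrix_vector_mul_linear] matrix_vector_mult_scaleR
        inner_sum_right right_diff_distrib sum_subtractf)
  also have "\<dots> = (\<Sum>k<N. D k * (dt * (\<Sum>i = 1..s. crk_b c s i *
      (m j i \<bullet> (K *v y k i) - m k i \<bullet> (K *v y j i)))))"
    unfolding m_def
    by (intro sum.cong refl arg_cong2[where f = "(*)"] crk_bilinear_increment[OF skew(2) b] z' j)
      auto
  also have "\<dots> = dt * (\<Sum>k<N. D k * (\<Sum>i = 1..s. crk_b c s i *
      (m j i \<bullet> (K *v y k i) - m k i \<bullet> (K *v y j i))))"
    by (simp add: sum_distrib_left mult_ac)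
  finally have K_incr: "z j 1 \<bullet> (K *v \<delta>x j 1) - z j 0 \<bullet> (K *v \<delta>x j 0) =
      dt * (\<Sum>k<N. D k * (\<Sum>i = 1..s. crk_b c s i *
      (m j i \<bullet> (K *v y k i) - m k i \<bullet> (K *v y j i))))" .

  have "local_energy S K x (z j 1) (\<delta>x j 1) - local_energy S K x (z j 0) (\<delta>x j 0)
      = (S (z j 1) x - S (z j 0) x) - 1 / 2 * (z j 1 \<bullet> (K *v \<delta>x j 1) - z j 0 \<bullet> (K *v \<delta>x j 0))"
    by (simp add: local_energy_def algebra_simps)
  \<comment> \<open>For fixed \<open>k\<close> let \<open>P\<close> and \<open>Q\<close> be the
    \<open>crk_b\<close>-weighted sums of \<open>m k i \<bullet> (K *v y j i)\<close> and
    \<open>m j i \<bullet> (K *v y k i)\<close>. The coefficient of \<open>dt * D k\<close> is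
    \<open>- P - (Q - P) / 2 = - (P + Q) / 2\<close>, and \<open>(P + Q) / 2\<close> is the
    flux.\<close>
  also have "\<dots> = - dt * (\<Sum>k<N. D k * local_flux c s K z \<delta>t j k)"
    unfolding S_incr K_incr local_flux_def m_def[symmetric] y_def[symmetric]
    by (simp add: ring_distribs sum.distrib sum_subtractf field_simps sum_divide_distrib[symmetric])
  finally show "(local_energy S K (grid_point x0 L N j) (z j 1) (\<delta>x j 1)
             - local_energy S K (grid_point x0 L N j) (z j 0) (\<delta>x j 0)) / dt
           + (\<Sum>k<N. fourier_D x0 L N j k * local_flux c s K z \<delta>t j k) = 0"
    using assms(7) by (simp add: x_def D_def)
qed

end
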